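(* Let $0\le m\le n$ be integers with $n\ge 1$, and let $\lambda_0,\ldots,\lambda_m\in\mathbb{C}$ be such that all the zeros of $\phi(z)=\sum_{i=0}^m\binom{n}{i}\lambda_i z^i$ lie in the half plane $|z|\le |z-\frac n2|$. Let $N$ be the associated operator on $\mathcal{P}_n$. If $P\in\mathcal{P}_n$ and $M=\max_{|z|=1}|P(z)|$, then $$|N[P](z)|\le |N[\psi_n](z)|\,M\quad\text{for } |z|\ge 1,$$ where $\psi_n(z)=z^n$. The result is sharp: equality holds for $P(z)=e^{i\alpha}Mz^n$, $\alpha\in\mathbb{R}$.
   Context: $\mathcal{P}_n$ denotes the class of all polynomials with complex coefficients of degree at most $n$. For given $\lambda_0,\ldots,\lambda_m\in\mathbb{C}$ the operator $N:\mathcal{P}_n\to\mathcal{P}_n$ is defined by $$N[P](z)=\sum_{i=0}^{m}\lambda_i\left(\frac{nz}{2}\right)^i\frac{P^{(i)}(z)}{i!},$$ where $P^{(i)}$ is the $i$-th derivative of $P$. *)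

theory Defs
  imports "HOL-Analysis.Analysis" "HOL-Computational_Algebra.Polynomial"
begin

text \<open>
  The class of complex polynomials of degree at most \<open>n\<close> is rendered as \<open>degree P \<le> n\<close>.
  The coefficients \<open>\<lambda>\<^sub>0, \<dots>, \<lambda>\<^sub>m\<close> are given by a function \<open>l\<close>, of which only the values at
  \<open>i \<le> m\<close> matter.
\<close>

definition Nop :: "nat \<Rightarrow> nat \<Rightarrow> (nat \<Rightarrow> complex) \<Rightarrow> complex poly \<Rightarrow> complex poly" where
  "Nop n m l P =
     (\<Sum>i=0..m. smult (l i / fact i) ([:0, of_nat n / 2:] ^ i * (pderiv ^^ i) P))"

lemma poly_Nop:
  "poly (Nop n m l P) z =
     (\<Sum>i=0..m. l i * (of_nat n * z / 2) ^ i * (poly ((pderiv ^^ i) P) z / fact i))"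
  by (simp add: Nop_def poly_sum mult_ac)

lemma degree_Nop_le:
  assumes "degree P \<le> n"
  shows "degree (Nop n m l P) \<le> n"
  unfolding Nop_def
proof (rule degree_sum_le)
  fix i
  let ?q = "(pderiv ^^ i) P"
  have deg: "degree ?q = degree P - i"
    by (induction i) (auto simp: degree_pderiv)
  show "degree (smult (l i / fact i) ([:0, of_nat n / 2:] ^ i * ?q)) \<le> n"
  proof (cases "?q = 0")
    case False
    have "i \<le> degree P"
    proof (rule ccontr)
      assume "\<not> i \<le> degree P"
      then obtain k where i: "i = Suc k" and k: "degree P \<le> k"
        by (cases i) auto
      have "degree ((pderiv ^^ k) P) = degree P - k"
        by (induction k) (auto simp: degree_pderiv)
      with k have "pderiv ((pderiv ^^ k) P) = 0"
        by (simp add: pderiv_eq_0_iff)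
      with False i show False by simp
    qed
    moreover have "degree ([:0, of_nat n / 2 :: complex:] ^ i) \<le> i"
      using degree_power_le[of "[:0, of_nat n / 2 :: complex:]" i]
      by (auto split: if_splits)
    ultimately have "degree ([:0, of_nat n / 2:] ^ i * ?q) \<le> degree P"
      using degree_mult_le[of "[:0, of_nat n / 2:] ^ i" ?q] deg by linarith
    with assms show ?thesis
      by (meson degree_smult_le le_trans)
  qed simp
qed simp

definition phi :: "nat \<Rightarrow> nat \<Rightarrow> (nat \<Rightarrow> complex) \<Rightarrow> complex poly" where
  "phi n m l = (\<Sum>i=0..m. monom (of_nat (n choose i) * l i) i)"

lemma poly_phi: "poly (phi n m l) z = (\<Sum>i=0..m. of_nat (n choose i) * l i * z ^ i)"
  by (simp add: phi_def poly_sum poly_monom)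

text \<open>
  The supremum over the unit circle is a maximum, as \<open>max_modulus_attained\<close> shows;
  \<open>Max\<close> is only meaningful on finite sets.
\<close>

definition max_modulus :: "complex poly \<Rightarrow> real" where
  "max_modulus P = (SUP z\<in>sphere 0 1. norm (poly P z))"

lemma max_modulus_attained:
  "\<exists>w. norm w = 1 \<and> norm (poly P w) = max_modulus P \<and>
       (\<forall>z. norm z = 1 \<longrightarrow> norm (poly P z) \<le> max_modulus P)"
proof -
  have "\<exists>w\<in>sphere (0::complex) 1. \<forall>z\<in>sphere 0 1. norm (poly P z) \<le> norm (poly P w)"
    by (rule continuous_attains_sup) (auto intro!: continuous_intros exI[of _ 1])
  then obtain w where w: "w \<in> sphere (0::complex) 1"
    and max: "\<And>z. z \<in> sphere 0 1 \<Longrightarrow> norm (poly P z) \<le> norm (poly P w)"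
    by blast
  have "max_modulus P = norm (poly P w)"
    unfolding max_modulus_def by (rule cSup_eq_maximum) (use w max in auto)
  with w max show ?thesis by auto
qed

end

theory Submission
  imports
    Defs
    "HOL-Computational_Algebra.Fundamental_Theorem_Algebra"
    "HOL-Complex_Analysis.Conformal_Mappings"
begin

text \<open>
  Fix \<open>z\<close> with \<open>\<bar>z\<bar> \<ge> 1\<close>. By Taylor's formula, \<open>N[P](z)\<close> is the value of the linear functional
  \<open>R \<mapsto> \<Sum> \<lambda>\<^sub>i [t\<^sup>i] R\<close> at \<open>R(t) = P(z + (n z / 2) t)\<close>. If \<open>P\<close> has exact degree \<open>n\<close> and all its
  zeros \<open>w\<^sub>j\<close> lie in the open unit disc, then up to a nonzero factor \<open>R(t) = \<Prod> (1 + x\<^sub>j t)\<close>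
  with \<open>x\<^sub>j = (n/2) / (1 - w\<^sub>j / z)\<close>, and \<open>Re x\<^sub>j > n/4\<close>. The functional then becomes
  \<open>\<Sum> \<lambda>\<^sub>i e\<^sub>i(x\<^sub>1, \<dots>, x\<^sub>n)\<close> with elementary symmetric \<open>e\<^sub>i\<close>, which is the symmetric multiaffine
  polarization of \<open>\<phi>\<close>. The hypothesis on \<open>\<phi>\<close> says that \<open>\<phi>\<close> has no zero with \<open>Re > n/4\<close>, so
  the half-plane case of the Grace--Walsh--Szego coincidence theorem
  (\<open>polarization_nonzero\<close>) shows \<open>N[P](z) \<noteq> 0\<close>; this is \<open>Nop_nonzero\<close>.

  The inequality follows by applying this to \<open>Q = P - \<kappa> \<psi>\<^sub>n\<close> with \<open>\<kappa> = N[P](z) / N[\<psi>\<^sub>n](z)\<close>.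
  Here \<open>N[Q](z) = 0\<close>. If \<open>\<bar>\<kappa>\<bar> > M\<close>, then the growth bound \<open>\<bar>P(w)\<bar> \<le> M \<bar>w\<bar>\<^sup>n\<close> for
  \<open>\<bar>w\<bar> \<ge> 1\<close> and the corresponding bound \<open>M\<close> on the coefficient of \<open>w\<^sup>n\<close> would make \<open>Q\<close> a
  polynomial of degree \<open>n\<close> with all zeros in the open unit disc: a contradiction.
\<close>

section \<open>Coincidence theorem for half-planes\<close>

lemma norm_inverse_minus_le_iff:
  fixes w :: complex
  assumes "w \<noteq> 0" "d > 0"
  shows "norm (1 / w - 1 / (2 * of_real d)) \<le> 1 / (2 * d) \<longleftrightarrow> d \<le> Re w"
proof -
  have "1 / w - 1 / (2 * of_real d) = (2 * of_real d - w) / (2 * of_real d * w)"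
    using assms by (simp add: field_simps)
  then have "norm (1 / w - 1 / (2 * of_real d)) = norm (2 * of_real d - w) / (2 * d * norm w)"
    using assms by (simp add: norm_divide norm_mult)
  also have "\<dots> \<le> 1 / (2 * d) \<longleftrightarrow> norm (2 * of_real d - w) \<le> norm w"
    using assms by (simp add: field_simps)
  also have "\<dots> \<longleftrightarrow> (norm (2 * of_real d - w))\<^sup>2 \<le> (norm w)\<^sup>2"
    by (simp add: abs_le_square_iff [symmetric])
  also have "\<dots> \<longleftrightarrow> d * d \<le> d * Re w"
    unfolding cmod_power2 by (simp add: power2_eq_square algebra_simps)
  also have "\<dots> \<longleftrightarrow> d \<le> Re w"
    using assms by simp
  finally show ?thesis .
qed

lemma poly_pderiv_prod_linear:
  fixes r :: "nat \<Rightarrow> complex"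
  assumes "\<And>i. i < k \<Longrightarrow> t \<noteq> r i"
  shows "poly (pderiv (\<Prod>i<k. [:- r i, 1:])) t =
           poly (\<Prod>i<k. [:- r i, 1:]) t * (\<Sum>i<k. 1 / (t - r i))"
  using assms
proof (induction k)
  case (Suc k)
  let ?G = "\<Prod>i<k. [:- r i, 1:]"
  have "poly (pderiv (\<Prod>i<Suc k. [:- r i, 1:])) t =
          poly (pderiv ?G) t * (t - r k) + poly ?G t"
    unfolding prod.lessThan_Suc pderiv_mult poly_add poly_mult
    by (simp add: pderiv_pCons)
  also have "\<dots> = poly ?G t * (t - r k) * ((\<Sum>i<k. 1 / (t - r i)) + 1 / (t - r k))"
    using Suc.IH Suc.prems [of k] Suc.prems by (simp add: distrib_left)
  also have "\<dots> = poly (\<Prod>i<Suc k. [:- r i, 1:]) t * (\<Sum>i<Suc k. 1 / (t - r i))"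
    unfolding prod.lessThan_Suc sum.lessThan_Suc poly_mult by simp
  finally show ?case .
qed simp

text \<open>
  The zeros of \<open>p\<close> lie in the half plane \<open>Re \<le> c\<close>, whose image under \<open>z \<mapsto> 1/(t - z)\<close> lies in a
  disc with \<open>0\<close> on its boundary. So \<open>p'(t)/(n p(t))\<close>, as the mean of \<open>n\<close> points of that disc
  (the value \<open>0\<close> standing for each of the \<open>n - degree p\<close> zeros at infinity), is in the disc,
  whereas vanishing of the left-hand side would put it at \<open>1/(t - x)\<close>, outside the disc.
  This is Laguerre's theorem on polar derivatives.
\<close>

lemma polar_derivative_nonzero:
  fixes p :: "complex poly"
  assumes deg: "degree p \<le> n" and n: "n > 0"
    and nz: "\<And>t. Re t > c \<Longrightarrow> poly p t \<noteq> 0"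
    and x: "Re x > c" and t: "Re t > c"
  shows "of_nat n * poly p t + (x - t) * poly (pderiv p) t \<noteq> 0"
proof
  assume eq: "of_nat n * poly p t + (x - t) * poly (pderiv p) t = 0"
  define d where "d = Re t - c"
  have d: "d > 0" using t by (simp add: d_def)
  have "p \<noteq> 0" using nz[OF t] by auto
  obtain r where p: "smult (lead_coeff p) (\<Prod>i<degree p. [:- r i, 1:]) = p"
    using complex_poly_decompose' [of p] by blast
  have root: "Re (r i) \<le> c" if "i < degree p" for i
  proof (rule ccontr)
    assume "\<not> Re (r i) \<le> c"
    then have "poly p (r i) \<noteq> 0" by (intro nz) simp
    moreover have "poly p (r i) = 0"
      using that by (subst p [symmetric]) (auto simp: poly_prod)
    ultimately show False by simp
  qed
  define s where "s = (\<Sum>i<degree p. 1 / (t - r i))"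
  have "poly (pderiv p) t = poly p t * s"
  proof -
    have "poly (pderiv (\<Prod>i<degree p. [:- r i, 1:])) t =
            poly (\<Prod>i<degree p. [:- r i, 1:]) t * s"
      unfolding s_def by (rule poly_pderiv_prod_linear) (metis root t not_le)
    then have "poly (pderiv (smult (lead_coeff p) (\<Prod>i<degree p. [:- r i, 1:]))) t =
            poly (smult (lead_coeff p) (\<Prod>i<degree p. [:- r i, 1:])) t * s"
      by (simp only: pderiv_smult poly_smult mult.assoc)
    then show ?thesis
      unfolding p .
  qed
  with eq have "poly p t * (of_nat n + (x - t) * s) = 0"
    by (simp add: algebra_simps)
  with nz[OF t] have "of_nat n + (x - t) * s = 0"
    by simp
  then have ns: "(t - x) * s = of_nat n"
    by (simp add: algebra_simps)
  have "t - x \<noteq> 0" using ns n by auto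
  \<comment> \<open>The circle of centre and radius \<open>1/(2d)\<close> is the image of the line \<open>Re w = d\<close> under \<open>w \<mapsto> 1/w\<close>.\<close>
  define e :: complex where "e = 1 / (2 * of_real d)"
  have ne: "norm e = 1 / (2 * d)"
    using d by (simp add: e_def norm_divide norm_mult)
  have "norm (1 / (t - r i) - e) \<le> 1 / (2 * d)" if "i < degree p" for i
    unfolding e_def using root[OF that] d
    by (subst norm_inverse_minus_le_iff) (auto simp: d_def)
  then have "norm (\<Sum>i<degree p. 1 / (t - r i) - e) \<le> of_nat (degree p) * (1 / (2 * d))"
    using sum_norm_bound [of "{..<degree p}" "\<lambda>i. 1 / (t - r i) - e" "1 / (2 * d)"] by simp
  moreover have "(\<Sum>i<degree p. 1 / (t - r i) - e) = s - of_nat (degree p) * e"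
    by (simp add: s_def sum_subtractf)
  ultimately have "norm (s - of_nat (degree p) * e) \<le> of_nat (degree p) * (1 / (2 * d))"
    by simp
  moreover have "norm (of_nat (n - degree p) * e) = of_nat (n - degree p) * (1 / (2 * d))"
    by (simp add: norm_mult ne)
  moreover have "(s - of_nat (degree p) * e) - of_nat (n - degree p) * e = s - of_nat n * e"
    using deg by (simp add: of_nat_diff algebra_simps)
  ultimately have "norm (s - of_nat n * e)
      \<le> of_nat (degree p) * (1 / (2 * d)) + of_nat (n - degree p) * (1 / (2 * d))"
    using norm_triangle_ineq4 [of "s - of_nat (degree p) * e" "of_nat (n - degree p) * e"]
    by (simp only:)
  also have "\<dots> = of_nat n * (1 / (2 * d))"
    using deg by (simp add: of_nat_diff add_divide_distrib diff_divide_distrib)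
  finally have "norm (s - of_nat n * e) \<le> of_nat n * (1 / (2 * d))" .
  moreover have "s - of_nat n * e = of_nat n * (1 / (t - x) - e)"
    using ns \<open>t - x \<noteq> 0\<close> by (simp add: field_simps)
  ultimately have "of_nat n * norm (1 / (t - x) - e) \<le> of_nat n * (1 / (2 * d))"
    by (simp add: norm_mult)
  then have "norm (1 / (t - x) - e) \<le> 1 / (2 * d)"
    using n by (simp only: mult_le_cancel_left_pos of_nat_0_less_iff)
  then have "d \<le> Re (t - x)"
    unfolding e_def using norm_inverse_minus_le_iff [OF \<open>t - x \<noteq> 0\<close> d] by simp
  with x show False by (simp add: d_def)
qed

definition binomial_poly :: "nat \<Rightarrow> (nat \<Rightarrow> 'a) \<Rightarrow> 'a::comm_ring_1 poly" where
  "binomial_poly n a = (\<Sum>i\<le>n. monom (of_nat (n choose i) * a i) i)"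

lemma coeff_binomial_poly: "coeff (binomial_poly n a) i = of_nat (n choose i) * a i"
proof -
  have "coeff (binomial_poly n a) i = (\<Sum>j\<le>n. if j = i then of_nat (n choose j) * a j else 0)"
    by (simp add: binomial_poly_def coeff_sum)
  also have "\<dots> = of_nat (n choose i) * a i"
    by (simp add: binomial_eq_0)
  finally show ?thesis .
qed

lemma degree_binomial_poly: "degree (binomial_poly n a) \<le> n"
  by (rule degree_le) (simp add: coeff_binomial_poly binomial_eq_0)

text \<open>
  In the coefficients normalised by binomials, the polar derivative with pole \<open>x\<close> is the shift
  \<open>a\<^sub>i \<mapsto> a\<^sub>i + x a\<^sub>i\<^sub>+\<^sub>1\<close>, the same shift that \<open>functional_mult_linear\<close> produces.
\<close>

lemma binomial_poly_polar:
  fixes a :: "nat \<Rightarrow> complex"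
  shows "smult (of_nat (Suc n)) (binomial_poly n (\<lambda>i. a i + x * a (Suc i))) =
     smult (of_nat (Suc n)) (binomial_poly (Suc n) a)
       + [:x, -1:] * pderiv (binomial_poly (Suc n) a)"
proof (rule poly_eqI)
  fix i
  have up: "of_nat (Suc i) * of_nat (Suc n choose Suc i) =
              (of_nat (Suc n) * of_nat (n choose i) :: complex)"
    by (metis Suc_times_binomial_eq mult.commute of_nat_mult)
  have down: "(of_nat (Suc n) - of_nat i) * of_nat (Suc n choose i) =
                (of_nat (Suc n) * of_nat (n choose i) :: complex)"
  proof (cases "i \<le> n")
    case True
    have "(Suc n - i) * (Suc n choose i) = Suc n * (n choose i)"
      using binomial_absorb_comp [of "Suc n" i] by simp
    then have "of_nat (Suc n - i) * of_nat (Suc n choose i) =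
                (of_nat (Suc n) * of_nat (n choose i) :: complex)"
      by (metis of_nat_mult)
    with True show ?thesis by (simp add: of_nat_diff)
  next
    case False
    then show ?thesis by (cases "i = Suc n") (auto simp: binomial_eq_0)
  qed
  have "coeff ([:x, -1:] * pderiv (binomial_poly (Suc n) a)) i =
          x * (of_nat (Suc i) * of_nat (Suc n choose Suc i)) * a (Suc i)
            - of_nat i * of_nat (Suc n choose i) * a i"
    by (cases i) (simp_all add: coeff_pderiv coeff_binomial_poly mult_ac del: binomial_Suc_Suc of_nat_Suc)
  then have "coeff (smult (of_nat (Suc n)) (binomial_poly (Suc n) a)
       + [:x, -1:] * pderiv (binomial_poly (Suc n) a)) i =
      ((of_nat (Suc n) - of_nat i) * of_nat (Suc n choose i)) * a i
        + x * (of_nat (Suc i) * of_nat (Suc n choose Suc i)) * a (Suc i)"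
    by (simp add: coeff_binomial_poly algebra_simps del: binomial_Suc_Suc of_nat_Suc)
  also have "\<dots> = coeff (smult (of_nat (Suc n))
                    (binomial_poly n (\<lambda>i. a i + x * a (Suc i)))) i"
    unfolding up down by (simp add: coeff_binomial_poly algebra_simps)
  finally show "coeff (smult (of_nat (Suc n)) (binomial_poly n (\<lambda>i. a i + x * a (Suc i)))) i =
    coeff (smult (of_nat (Suc n)) (binomial_poly (Suc n) a)
       + [:x, -1:] * pderiv (binomial_poly (Suc n) a)) i" by simp
qed

lemma functional_mult_linear:
  fixes R :: "'a::comm_ring_1 poly"
  assumes "degree R \<le> n"
  shows "(\<Sum>i\<le>Suc n. a i * coeff (R * [:1, x:]) i) =
           (\<Sum>i\<le>n. (a i + x * a (Suc i)) * coeff R i)"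
proof -
  have "R * [:1, x:] = R + smult x (pCons 0 R)"
    by simp
  then have "(\<Sum>i\<le>Suc n. a i * coeff (R * [:1, x:]) i) =
          (\<Sum>i\<le>Suc n. a i * coeff R i) + x * (\<Sum>i\<le>Suc n. a i * coeff (pCons 0 R) i)"
    by (simp only: coeff_add coeff_smult sum_distrib_left sum.distrib distrib_left mult.left_commute)
  also have "(\<Sum>i\<le>Suc n. a i * coeff R i) = (\<Sum>i\<le>n. a i * coeff R i)"
    using assms by (simp add: coeff_eq_0)
  also have "(\<Sum>i\<le>Suc n. a i * coeff (pCons 0 R) i) = (\<Sum>i\<le>n. a (Suc i) * coeff R i)"
    by (subst sum.atMost_Suc_shift) simp
  finally show ?thesis
    by (simp add: sum_distrib_left algebra_simps flip: sum.distrib)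
qed

text \<open>
  The coefficients of \<open>\<Prod> (1 + x\<^sub>j t)\<close> are the elementary symmetric functions of the \<open>x\<^sub>j\<close>, so
  the sum is the polarization of \<open>binomial_poly n a\<close>. Splitting off one point \<open>x\<^sub>j\<close> replaces
  \<open>binomial_poly n a\<close> by its polar derivative with pole \<open>x\<^sub>j\<close>, which again has no zeros in
  the half plane; after \<open>n\<close> steps only a nonzero constant is left.
\<close>

lemma polarization_nonzero:
  fixes a :: "nat \<Rightarrow> complex"
  assumes "\<And>t. Re t > c \<Longrightarrow> poly (binomial_poly n a) t \<noteq> 0"
    and "\<And>j. j < n \<Longrightarrow> Re (x j) > c"
  shows "(\<Sum>i\<le>n. a i * coeff (\<Prod>j<n. [:1, x j:]) i) \<noteq> 0"
  using assms
proof (induction n arbitrary: a)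
  case 0
  show ?case
    using 0(1)[of "of_real (c + 1)"] by (simp add: binomial_poly_def poly_monom)
next
  case (Suc n)
  let ?b = "\<lambda>i. a i + x n * a (Suc i)"
  have "poly (binomial_poly n ?b) t \<noteq> 0" if t: "Re t > c" for t
  proof
    assume "poly (binomial_poly n ?b) t = 0"
    then have "poly (smult (of_nat (Suc n)) (binomial_poly n ?b)) t = 0"
      by simp
    then have "of_nat (Suc n) * poly (binomial_poly (Suc n) a) t +
                 (x n - t) * poly (pderiv (binomial_poly (Suc n) a)) t = 0"
      unfolding binomial_poly_polar by (simp add: algebra_simps)
    then show False
      using polar_derivative_nonzero [OF degree_binomial_poly _ Suc.prems(1)] Suc.prems(2) t
      by blast
  qed
  then have "(\<Sum>i\<le>n. ?b i * coeff (\<Prod>j<n. [:1, x j:]) i) \<noteq> 0"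
    by (rule Suc.IH) (use Suc.prems(2) in auto)
  moreover have "degree (\<Prod>j<n. [:1, x j:]) \<le> n"
  proof -
    have "(\<Sum>j<n. degree [:1, x j:]) \<le> of_nat (card {..<n}) * 1"
      by (rule sum_bounded_above) simp
    then show ?thesis
      using degree_prod_sum_le [of "{..<n}" "\<lambda>j. [:1, x j:]"] by (simp add: o_def)
  qed
  ultimately show ?case
    using functional_mult_linear [of "\<Prod>j<n. [:1, x j:]" n a "x n"] by (simp add: del: mult_pCons_right)
qed

section \<open>The operator as a linear functional of the Taylor expansion\<close>

lemma coeff_pcompose_linear:
  fixes P :: "'a::field_char_0 poly"
  shows "coeff (pcompose P [:z, h:]) i = h ^ i * poly ((pderiv ^^ i) P) z / fact i"
proof (induction i arbitrary: P)
  case 0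
  show ?case by (simp add: poly_pcompose flip: poly_0_coeff_0)
next
  case (Suc i)
  have "of_nat (Suc i) * coeff (pcompose P [:z, h:]) (Suc i) =
          coeff (pderiv (pcompose P [:z, h:])) i"
    by (simp add: coeff_pderiv)
  also have "\<dots> = h * coeff (pcompose (pderiv P) [:z, h:]) i"
    by (simp add: pderiv_pcompose pderiv_pCons)
  also have "\<dots> = h * (h ^ i * poly ((pderiv ^^ i) (pderiv P)) z / fact i)"
    by (simp only: Suc)
  finally show ?case
    by (simp add: funpow_swap1 field_simps del: of_nat_Suc)
qed

lemma poly_Nop_eq_functional:
  assumes "m \<le> n"
  shows "poly (Nop n m l P) z =
     (\<Sum>i\<le>n. (if i \<le> m then l i else 0) * coeff (pcompose P [:z, of_nat n * z / 2:]) i)"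
proof -
  have "poly (Nop n m l P) z =
          (\<Sum>i\<in>{0..m}. (if i \<le> m then l i else 0) * coeff (pcompose P [:z, of_nat n * z / 2:]) i)"
    by (auto simp: poly_Nop coeff_pcompose_linear intro!: sum.cong)
  also have "\<dots> = (\<Sum>i\<le>n. (if i \<le> m then l i else 0) *
                    coeff (pcompose P [:z, of_nat n * z / 2:]) i)"
    using assms by (intro sum.mono_neutral_left) auto
  finally show ?thesis .
qed

lemma poly_Nop_smult:
  assumes "m \<le> n"
  shows "poly (Nop n m l (smult k P)) z = k * poly (Nop n m l P) z"
  by (simp add: poly_Nop_eq_functional [OF assms] pcompose_smult sum_distrib_left mult_ac)

lemma poly_Nop_diff:
  assumes "m \<le> n"
  shows "poly (Nop n m l (P - Q)) z = poly (Nop n m l P) z - poly (Nop n m l Q) z"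
  by (simp add: poly_Nop_eq_functional [OF assms] pcompose_diff sum_subtractf algebra_simps)

lemma phi_eq_binomial_poly:
  assumes "m \<le> n"
  shows "phi n m l = binomial_poly n (\<lambda>i. if i \<le> m then l i else 0)"
proof -
  have "phi n m l = (\<Sum>i\<in>{0..m}. monom (of_nat (n choose i) * (if i \<le> m then l i else 0)) i)"
    by (simp add: phi_def)
  also have "\<dots> = binomial_poly n (\<lambda>i. if i \<le> m then l i else 0)"
    unfolding binomial_poly_def using assms by (intro sum.mono_neutral_left) auto
  finally show ?thesis .
qed

lemma norm_le_norm_minus_iff:
  assumes "r > 0"
  shows "norm z \<le> norm (z - of_real r) \<longleftrightarrow> Re z \<le> r / 2"
proof -
  have "norm z \<le> norm (z - of_real r) \<longleftrightarrow> (norm z)\<^sup>2 \<le> (norm (z - of_real r))\<^sup>2"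
    by (simp add: abs_le_square_iff [symmetric])
  also have "\<dots> \<longleftrightarrow> r * (2 * Re z) \<le> r * r"
    unfolding cmod_power2 by (simp add: power2_eq_square algebra_simps)
  also have "\<dots> \<longleftrightarrow> Re z \<le> r / 2"
    using assms by auto
  finally show ?thesis .
qed

text \<open>
  For \<open>\<bar>w\<bar> < \<bar>z\<bar>\<close> the point \<open>1 - w/z\<close> lies in the open disc of radius \<open>1\<close> about \<open>1\<close>, and
  inversion maps this disc onto the half plane \<open>Re > 1/2\<close>.
\<close>

lemma Re_divide_diff_gt:
  assumes "norm w < norm z" "h > 0"
  shows "Re (of_real h * z / (z - w)) > h / 2"
proof -
  have "z \<noteq> w" "z \<noteq> 0" using assms by auto
  define v where "v = z / (z - w)"
  have "v \<noteq> 0" using \<open>z \<noteq> w\<close> \<open>z \<noteq> 0\<close> by (simp add: v_def)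
  have "v - 1 = v * (w / z)"
    using \<open>z \<noteq> w\<close> \<open>z \<noteq> 0\<close> by (simp add: v_def field_simps)
  then have "norm (v - 1) = norm v * (norm w / norm z)"
    by (simp add: norm_mult norm_divide)
  also have "\<dots> < norm v * 1"
    using assms \<open>v \<noteq> 0\<close> \<open>z \<noteq> 0\<close> by (intro mult_strict_left_mono) auto
  finally have "Re v > 1 / 2"
    using norm_le_norm_minus_iff [of 1 v] by simp
  then have "h * Re v > h * (1 / 2)"
    using assms by (intro mult_strict_left_mono) auto
  moreover have "of_real h * z / (z - w) = of_real h * v"
    by (simp add: v_def)
  ultimately show ?thesis by simp
qed

text \<open>
  Substituting \<open>z + (n z / 2) t\<close> turns the zeros \<open>w\<^sub>j\<close> into points \<open>x\<^sub>j\<close> of the half plane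
  \<open>Re > n/4\<close>, the complement of the half plane that contains the zeros of \<open>\<phi>\<close>. The degree
  must be exactly \<open>n\<close> for there to be \<open>n\<close> such points.
\<close>

lemma Nop_nonzero:
  assumes mn: "m \<le> n" and n: "n \<ge> 1"
    and phi: "\<And>z. poly (phi n m l) z = 0 \<Longrightarrow> norm z \<le> norm (z - of_nat n / 2)"
    and deg: "degree Q = n"
    and zeros: "\<And>w. poly Q w = 0 \<Longrightarrow> norm w < 1"
    and z: "norm z \<ge> 1"
  shows "poly (Nop n m l Q) z \<noteq> 0"
proof -
  let ?a = "\<lambda>i. if i \<le> m then l i else 0"
  have "Q \<noteq> 0" using deg n by auto
  obtain w where Q: "smult (lead_coeff Q) (\<Prod>j<n. [:- w j, 1:]) = Q"
    using complex_poly_decompose' [of Q] deg by metis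
  have w: "norm (w j) < norm z" if "j < n" for j
  proof -
    have "poly Q (w j) = 0"
      using that by (subst Q [symmetric]) (auto simp: poly_prod)
    then show ?thesis using zeros z by fastforce
  qed
  then have zw: "z - w j \<noteq> 0" if "j < n" for j
    using that by fastforce
  let ?h = "of_nat n * z / 2"
  define x where "x j = ?h / (z - w j)" for j
  define K where "K = lead_coeff Q * (\<Prod>j<n. z - w j)"
  have "K \<noteq> 0"
    using \<open>Q \<noteq> 0\<close> zw by (auto simp: K_def)
  \<comment> \<open>\<open>z + h t - w\<^sub>j = (z - w\<^sub>j) (1 + x\<^sub>j t)\<close> with \<open>h = n z / 2\<close>\<close>
  have fac: "pcompose [:- w j, 1:] [:z, ?h:] = smult (z - w j) [:1, x j:]" if "j < n" for j
  proof -
    have "(z - w j) * x j = ?h"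
      unfolding x_def
      by (subst times_divide_eq_right) (rule nonzero_mult_div_cancel_left [OF zw[OF that]])
    then show ?thesis
      by (simp add: pcompose_pCons)
  qed
  have "pcompose Q [:z, ?h:] =
          smult (lead_coeff Q) (\<Prod>j<n. pcompose [:- w j, 1:] [:z, ?h:])"
    by (subst Q [symmetric]) (simp only: pcompose_smult pcompose_prod)
  also have "(\<Prod>j<n. pcompose [:- w j, 1:] [:z, ?h:]) = (\<Prod>j<n. smult (z - w j) [:1, x j:])"
    by (rule prod.cong) (use fac in auto)
  also have "smult (lead_coeff Q) \<dots> = smult K (\<Prod>j<n. [:1, x j:])"
    by (simp only: prod_smult K_def smult_smult)
  finally have "poly (Nop n m l Q) z = K * (\<Sum>i\<le>n. ?a i * coeff (\<Prod>j<n. [:1, x j:]) i)"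
    by (simp add: poly_Nop_eq_functional [OF mn] sum_distrib_left mult_ac)
  moreover have "(\<Sum>i\<le>n. ?a i * coeff (\<Prod>j<n. [:1, x j:]) i) \<noteq> 0"
  proof (rule polarization_nonzero [where c = "n / 4"])
    fix t assume "Re t > n / 4"
    then show "poly (binomial_poly n ?a) t \<noteq> 0"
      using phi [of t] norm_le_norm_minus_iff [of "n / 2" t] n
      by (auto simp: phi_eq_binomial_poly [OF mn])
  next
    fix j assume "j < n"
    then show "Re (x j) > n / 4"
      using Re_divide_diff_gt [OF w, of j "n / 2"] n by (simp add: x_def)
  qed
  ultimately show ?thesis
    using \<open>K \<noteq> 0\<close> by simp
qed

section \<open>Growth outside the unit disc\<close>

lemma norm_poly_le_max_modulus: "norm z = 1 \<Longrightarrow> norm (poly P z) \<le> max_modulus P"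
  using max_modulus_attained [of P] by blast

lemma poly_reversed:
  fixes P :: "'a::field poly"
  assumes "degree P \<le> n" "u \<noteq> 0"
  shows "(\<Sum>i\<le>n. coeff P i * u ^ (n - i)) = u ^ n * poly P (1 / u)"
proof -
  have "poly P (1 / u) = (\<Sum>i\<le>n. coeff P i * (1 / u) ^ i)"
    unfolding poly_altdef using assms(1)
    by (intro sum.mono_neutral_left) (auto simp: coeff_eq_0)
  then show ?thesis
    using assms(2) by (auto simp: sum_distrib_left power_diff field_simps intro!: sum.cong)
qed

text \<open>
  The maximum principle is applied to the reversed polynomial \<open>u\<^sup>n P(1/u)\<close>, which agrees in
  modulus with \<open>P(1/u)\<close> on the unit circle. Including \<open>u = 0\<close> gives the bound on the
  coefficient of degree \<open>n\<close>.
\<close>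

lemma norm_reversed_le_max_modulus:
  assumes deg: "degree P \<le> n" and u: "norm u \<le> 1"
  shows "norm (\<Sum>i\<le>n. coeff P i * u ^ (n - i)) \<le> max_modulus P"
proof (rule maximum_modulus_frontier [of "\<lambda>u. \<Sum>i\<le>n. coeff P i * u ^ (n - i)" "cball 0 1"])
  fix v :: complex assume "v \<in> frontier (cball 0 1)"
  then have v: "norm v = 1" by simp
  then have "v \<noteq> 0" by auto
  then have "norm (\<Sum>i\<le>n. coeff P i * v ^ (n - i)) = norm (poly P (1 / v))"
    by (simp add: poly_reversed [OF deg] norm_mult norm_power v)
  then show "norm (\<Sum>i\<le>n. coeff P i * v ^ (n - i)) \<le> max_modulus P"
    using v by (simp add: norm_poly_le_max_modulus norm_divide)
qed (use u in \<open>auto intro!: holomorphic_intros continuous_intros\<close>)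

lemma norm_poly_le_outside:
  assumes deg: "degree P \<le> n" and w: "norm w \<ge> 1"
  shows "norm (poly P w) \<le> max_modulus P * norm w ^ n"
proof -
  have "w \<noteq> 0" using w by auto
  have "norm (\<Sum>i\<le>n. coeff P i * (1 / w) ^ (n - i)) \<le> max_modulus P"
    using w by (intro norm_reversed_le_max_modulus [OF deg]) (simp add: norm_divide divide_le_eq_1)
  also have "(\<Sum>i\<le>n. coeff P i * (1 / w) ^ (n - i)) = poly P w / w ^ n"
    using poly_reversed [OF deg, of "1 / w"] \<open>w \<noteq> 0\<close> by (simp add: power_divide)
  finally show ?thesis
    using \<open>w \<noteq> 0\<close> by (simp add: norm_power norm_divide field_simps)
qed

lemma norm_coeff_le_max_modulus:
  assumes "degree P \<le> n"
  shows "norm (coeff P n) \<le> max_modulus P"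
proof -
  have "(\<Sum>i\<le>n. coeff P i * 0 ^ (n - i)) = (\<Sum>i\<le>n. if i = n then coeff P i else 0)"
    by (rule sum.cong) auto
  then show ?thesis
    using norm_reversed_le_max_modulus [OF assms, of 0] by simp
qed

lemma max_modulus_monom: "max_modulus (monom k n) = norm k"
  using max_modulus_attained [of "monom k n"]
  by (auto simp: poly_monom norm_mult norm_power)

section \<open>Comparison with the extremal monomial\<close>

text \<open>
  The multiple of \<open>\<psi>\<^sub>n\<close> subtracted from \<open>P\<close> is the one that makes \<open>N\<close> vanish at \<open>z\<close>. A
  violation of the inequality makes its factor \<open>\<kappa>\<close> exceed \<open>max_modulus P\<close>, and then
  \<open>\<kappa> w\<^sup>n\<close> dominates \<open>P\<close> outside the open disc, as well as in the coefficient of degree \<open>n\<close>,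
  contradicting \<open>Nop_nonzero\<close>.
\<close>

lemma Nop_le_Nop_monom:
  assumes mn: "m \<le> n" and n: "n \<ge> 1"
    and phi: "\<And>z. poly (phi n m l) z = 0 \<Longrightarrow> norm z \<le> norm (z - of_nat n / 2)"
    and deg: "degree P \<le> n" and z: "norm z \<ge> 1"
  shows "norm (poly (Nop n m l P) z) \<le> norm (poly (Nop n m l (monom 1 n)) z) * max_modulus P"
proof (rule ccontr)
  let ?N = "\<lambda>P. poly (Nop n m l P) z"
  let ?\<psi> = "monom 1 n :: complex poly"
  have N\<psi>: "?N ?\<psi> \<noteq> 0"
    by (rule Nop_nonzero [OF mn n phi _ _ z])
       (use n in \<open>auto simp: degree_monom_eq poly_monom\<close>)
  define \<kappa> where "\<kappa> = ?N P / ?N ?\<psi>"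
  assume "\<not> norm (?N P) \<le> norm (?N ?\<psi>) * max_modulus P"
  then have \<kappa>: "norm \<kappa> > max_modulus P"
    using N\<psi> by (simp add: \<kappa>_def norm_divide field_simps)
  define Q where "Q = P - smult \<kappa> ?\<psi>"
  have "degree Q = n"
  proof (rule antisym)
    show "degree Q \<le> n"
      unfolding Q_def using deg degree_smult_le [of \<kappa> ?\<psi>] degree_monom_le [of "1::complex" n]
      by (intro degree_diff_le) linarith+
    have "coeff Q n \<noteq> 0"
      using norm_coeff_le_max_modulus [OF deg] \<kappa> by (auto simp: Q_def)
    then show "n \<le> degree Q" by (rule le_degree)
  qed
  moreover have "norm w < 1" if "poly Q w = 0" for w
  proof (rule ccontr)
    assume "\<not> norm w < 1"
    then have w: "norm w \<ge> 1" by simp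
    have "norm \<kappa> * norm w ^ n = norm (poly P w)"
      using that by (simp add: Q_def poly_monom norm_mult norm_power)
    also have "\<dots> \<le> max_modulus P * norm w ^ n"
      by (rule norm_poly_le_outside [OF deg w])
    also have "\<dots> < norm \<kappa> * norm w ^ n"
      using \<kappa> w by (intro mult_strict_right_mono zero_less_power) auto
    finally show False by simp
  qed
  ultimately have "?N Q \<noteq> 0"
    using Nop_nonzero [OF mn n phi \<open>degree Q = n\<close> _ z] by blast
  moreover have "?N Q = 0"
    using N\<psi> by (simp only: Q_def poly_Nop_diff [OF mn] poly_Nop_smult [OF mn]) (simp add: \<kappa>_def)
  ultimately show False by simp
qed

theorem corollary1p1:
  fixes n m :: nat and l :: "nat \<Rightarrow> complex"
  assumes "m \<le> n" and "n \<ge> 1"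
    and "\<And>z. poly (phi n m l) z = 0 \<Longrightarrow> norm z \<le> norm (z - of_nat n / 2)"
  shows "(\<forall>P M. degree P \<le> n \<and> M = max_modulus P \<longrightarrow>
            (\<forall>z. norm z \<ge> 1 \<longrightarrow>
              norm (poly (Nop n m l P) z) \<le> norm (poly (Nop n m l (monom 1 n)) z) * M))
       \<and> (\<forall>(\<alpha>::real) (M::real) P. M \<ge> 0 \<and> P = monom (exp (\<i> * of_real \<alpha>) * of_real M) n \<longrightarrow>
            degree P \<le> n \<and> max_modulus P = M \<and>
            (\<forall>z. norm z \<ge> 1 \<longrightarrow>
              norm (poly (Nop n m l P) z) = norm (poly (Nop n m l (monom 1 n)) z) * M))"
proof (intro conjI allI impI; (elim conjE)?)
  fix P M z
  assume "degree P \<le> n" "M = max_modulus P" "norm (z::complex) \<ge> 1"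
  then show "norm (poly (Nop n m l P) z) \<le> norm (poly (Nop n m l (monom 1 n)) z) * M"
    using Nop_le_Nop_monom [OF assms] by simp
next
  fix \<alpha> M :: real and P :: "complex poly"
  assume M: "M \<ge> 0" and P: "P = monom (exp (\<i> * of_real \<alpha>) * of_real M) n"
  have k: "norm (exp (\<i> * of_real \<alpha>) * of_real M) = M"
    using M by (simp add: norm_mult)
  show "degree P \<le> n"
    unfolding P by (rule degree_monom_le)
  show "max_modulus P = M"
    unfolding P max_modulus_monom by (rule k)
  fix z :: complex
  have "P = smult (exp (\<i> * of_real \<alpha>) * of_real M) (monom 1 n)"
    by (simp add: P smult_monom)
  then show "norm (poly (Nop n m l P) z) = norm (poly (Nop n m l (monom 1 n)) z) * M"
    using poly_Nop_smult [OF assms(1), of l "exp (\<i> * of_real \<alpha>) * of_real M" "monom 1 n" z] k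
    by (simp add: norm_mult mult.commute)
qed

end
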